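(* Let $n \geq 3$ and let $\rho,\sigma \in M_n(\mathbb{C})$ be density matrices. If $E_\rho(V) = E_\sigma(V)$ for every context $V\in\mathcal{V}(M_n)$, then $\rho=\sigma$. That is, a quantum state on a Hilbert space of finite dimension $n\geq 3$ is uniquely determined by its contextual entropy.
   Context: $M_n = M_n(\mathbb{C})$ is the algebra of complex $n\times n$ matrices. A density matrix is a positive semidefinite matrix $\rho\in M_n$ with $\mathrm{Tr}\,\rho=1$. A context is a commutative $*$-subalgebra $V\subseteq M_n$ containing the identity $I$, with $V\neq\mathbb{C}I$; $\mathcal{V}(M_n)$ denotes the set of all contexts. Each context is $V=\mathbb{C}P_1+\dots+\mathbb{C}P_k$ for a unique (up to order) set $\{P_1,\dots,P_k\}$ of nonzero pairwise orthogonal projections with $P_1+\dots+P_k=I$; these are called the canonical projections of $V$, and one writes $V=\{P_1,\dots,P_k\}''$. The contextual entropy of $\rho$ is the function $E_\rho:\mathcal{V}(M_n)\to[0,\ln n]$, $$E_\rho(V) = -\sum_{i=1}^k \mathrm{Tr}(\rho P_i)\ln \mathrm{Tr}(\rho P_i),\qquad V=\{P_1,\dots,P_k\}'',$$ with the convention $0\ln 0=0$. *)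

theory Defs
  imports "HOL-Analysis.Analysis"
begin

definition mat_adj :: "complex^'n^'m \<Rightarrow> complex^'m^'n" where
  "mat_adj A = map_matrix cnj (transpose A)"

definition mat_smult :: "complex \<Rightarrow> complex^'n^'m \<Rightarrow> complex^'n^'m" where
  "mat_smult c A = map_matrix ((*) c) A"

definition pos_semidef :: "complex^'n^'n \<Rightarrow> bool" where
  "pos_semidef A \<longleftrightarrow>
     mat_adj A = A \<and> (\<forall>v. 0 \<le> Re (\<Sum>i\<in>UNIV. cnj (v $ i) * (A *v v) $ i))"

definition density_matrix :: "complex^'n^'n \<Rightarrow> bool" where
  "density_matrix \<rho> \<longleftrightarrow> pos_semidef \<rho> \<and> trace \<rho> = 1"

definition star_subalgebra :: "(complex^'n^'n) set \<Rightarrow> bool" where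
  "star_subalgebra V \<longleftrightarrow>
     0 \<in> V \<and>
     (\<forall>A\<in>V. \<forall>B\<in>V. A + B \<in> V) \<and>
     (\<forall>c. \<forall>A\<in>V. mat_smult c A \<in> V) \<and>
     (\<forall>A\<in>V. \<forall>B\<in>V. A ** B \<in> V) \<and>
     (\<forall>A\<in>V. mat_adj A \<in> V)"

definition contexts :: "(complex^'n^'n) set set" where
  "contexts = {V. star_subalgebra V \<and>
     (\<forall>A\<in>V. \<forall>B\<in>V. A ** B = B ** A) \<and>
     mat 1 \<in> V \<and>
     V \<noteq> range (\<lambda>c. mat_smult c (mat 1))}"

definition projection :: "complex^'n^'n \<Rightarrow> bool" where
  "projection P \<longleftrightarrow> mat_adj P = P \<and> P ** P = P"

definition is_canonical_projections ::
    "(complex^'n^'n) set \<Rightarrow> (complex^'n^'n) set \<Rightarrow> bool" where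
  "is_canonical_projections V S \<longleftrightarrow>
     finite S \<and>
     (\<forall>P\<in>S. projection P \<and> P \<noteq> 0) \<and>
     (\<forall>P\<in>S. \<forall>Q\<in>S. P \<noteq> Q \<longrightarrow> P ** Q = 0) \<and>
     (\<Sum>P\<in>S. P) = mat 1 \<and>
     V = range (\<lambda>c. \<Sum>P\<in>S. mat_smult (c P) P)"

definition canonical_projections :: "(complex^'n^'n) set \<Rightarrow> (complex^'n^'n) set" where
  "canonical_projections V = (THE S. is_canonical_projections V S)"

(* Tr (rho P) is real for a density matrix rho and a projection P, so Re loses nothing;
   0 * ln 0 = 0 holds automatically. *)
definition contextual_entropy :: "complex^'n^'n \<Rightarrow> (complex^'n^'n) set \<Rightarrow> real" where
  "contextual_entropy \<rho> V =
     - (\<Sum>P\<in>canonical_projections V. Re (trace (\<rho> ** P)) * ln (Re (trace (\<rho> ** P))))"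

end

(* A context spanned by a projection P and its complement determines the binary entropy of
   Tr(rho P), so Tr(sigma P) is either Tr(rho P) or 1 - Tr(rho P). If the second value is taken, and
   is different from the first, for the projection P onto the line of a unit vector x, then applying
   this dichotomy to a projection Q orthogonal to P and to P + Q forces
   Tr(rho Q) to be 0 or d = 1 - Tr(rho P). As n >= 3, each unit vector y orthogonal to x has a
   companion z orthonormal to x and y. A quadratic form on the span of y, z with values in {0, d} on
   unit vectors is constant there, and the value d is impossible because Q = P_y + P_z
   would have 2d. Hence rho vanishes on the complement of x and Tr(rho P) = 1; by symmetry
   Tr(sigma P) = 1, contradicting that the two differ. So rho and sigma have the same quadratic
   form. *)
theory Submission
  imports Defs
begin

section \<open>Hermitian inner product and matrix arithmetic\<close>

definition cinner :: "complex^'n \<Rightarrow> complex^'n \<Rightarrow> complex" where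
  "cinner x y = (\<Sum>i\<in>UNIV. cnj (x $ i) * y $ i)"

text \<open>The outer product of x with itself; for a unit vector, the orthogonal projection onto
  the complex line of x.\<close>

definition rank_one :: "complex^'n \<Rightarrow> complex^'n^'n" where
  "rank_one x = (\<chi> i j. x $ i * cnj (x $ j))"

definition expect :: "complex^'n^'n \<Rightarrow> complex^'n^'n \<Rightarrow> real" where
  "expect \<rho> P = Re (trace (\<rho> ** P))"

text \<open>Links the two products in use: quadratic forms and norms are handled with the real
  \<open>\<bullet>\<close>, complex orthogonality with \<open>cinner\<close>.\<close>

lemma Re_cinner: "Re (cinner x y) = x \<bullet> y"
  by (simp add: cinner_def inner_vec_def inner_complex_def)

lemma cinner_commute: "cinner y x = cnj (cinner x y)"
  by (simp add: cinner_def mult.commute)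

lemma cinner_add_right: "cinner x (y + z) = cinner x y + cinner x z"
  by (simp add: cinner_def algebra_simps sum.distrib)

lemma cinner_scaleR_right: "cinner x (r *\<^sub>R y) = r *\<^sub>R cinner x y"
  by (simp add: cinner_def scaleR_right.sum)

lemma cinner_self: "cinner x x = of_real (x \<bullet> x)"
proof -
  have "cnj (x $ i) * x $ i = of_real (x $ i \<bullet> x $ i)" for i
    by (simp add: complex_eq_iff inner_complex_def)
  then show ?thesis
    by (simp add: cinner_def inner_vec_def)
qed

lemma mat_adj_nth: "mat_adj A $ i $ j = cnj (A $ j $ i)"
  by (simp add: mat_adj_def transpose_def map_matrix_def)

lemma mat_smult_nth: "mat_smult c A $ i $ j = c * A $ i $ j"
  by (simp add: mat_smult_def map_matrix_def)

lemma mat_adj_mult: "mat_adj (A ** B) = mat_adj B ** mat_adj A"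
  by (simp add: vec_eq_iff mat_adj_nth matrix_matrix_mult_def mult.commute)

lemma mat_adj_add: "mat_adj (A + B) = mat_adj A + mat_adj B"
  by (simp add: vec_eq_iff mat_adj_nth)

lemma mat_adj_diff: "mat_adj (A - B) = mat_adj A - mat_adj B"
  by (simp add: vec_eq_iff mat_adj_nth)

lemma mat_adj_zero [simp]: "mat_adj 0 = 0"
  by (simp add: vec_eq_iff mat_adj_nth)

lemma mat_adj_one [simp]: "mat_adj (mat 1) = mat 1"
  by (auto simp: vec_eq_iff mat_adj_nth mat_def)

lemma mat_adj_smult: "mat_adj (mat_smult c A) = mat_smult (cnj c) (mat_adj A)"
  by (simp add: vec_eq_iff mat_adj_nth mat_smult_nth)

lemma mat_smult_mult_left: "mat_smult c A ** B = mat_smult c (A ** B)"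
  by (simp add: vec_eq_iff mat_smult_nth matrix_matrix_mult_def sum_distrib_left mult.assoc)

lemma mat_smult_mult_right: "A ** mat_smult c B = mat_smult c (A ** B)"
  by (simp add: vec_eq_iff mat_smult_nth matrix_matrix_mult_def sum_distrib_left mult.left_commute)

lemma mat_smult_smult: "mat_smult c (mat_smult d A) = mat_smult (c * d) A"
  by (simp add: vec_eq_iff mat_smult_nth mult.assoc)

lemma mat_smult_add_left: "mat_smult (c + d) A = mat_smult c A + mat_smult d A"
  by (simp add: vec_eq_iff mat_smult_nth algebra_simps)

lemma mat_smult_add_right: "mat_smult c (A + B) = mat_smult c A + mat_smult c B"
  by (simp add: vec_eq_iff mat_smult_nth algebra_simps)

lemma mat_smult_one [simp]: "mat_smult 1 A = A"
  by (simp add: vec_eq_iff mat_smult_nth)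

lemma mat_smult_zero_left [simp]: "mat_smult 0 A = 0"
  by (simp add: vec_eq_iff mat_smult_nth)

lemma mat_smult_zero_right [simp]: "mat_smult c 0 = 0"
  by (simp add: vec_eq_iff mat_smult_nth)

lemma matrix_add_rdistrib: "(A + B) ** (C :: complex^'n^'n) = A ** C + B ** C"
  by (simp add: vec_eq_iff matrix_matrix_mult_def algebra_simps sum.distrib)

lemma matrix_diff_ldistrib: "(A :: complex^'n^'n) ** (B - C) = A ** B - A ** C"
  by (simp add: vec_eq_iff matrix_matrix_mult_def algebra_simps sum_subtractf)

lemma matrix_diff_rdistrib: "(A - B) ** (C :: complex^'n^'n) = A ** C - B ** C"
  by (simp add: vec_eq_iff matrix_matrix_mult_def algebra_simps sum_subtractf)

lemma matrix_mult_sum_left: "(\<Sum>i\<in>S. f i) ** (B :: complex^'n^'n) = (\<Sum>i\<in>S. f i ** B)"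
  by (induction S rule: infinite_finite_induct) (simp_all add: matrix_add_rdistrib)

lemma matrix_mult_sum_right: "(B :: complex^'n^'n) ** (\<Sum>i\<in>S. f i) = (\<Sum>i\<in>S. B ** f i)"
  by (induction S rule: infinite_finite_induct) (simp_all add: matrix_add_ldistrib)

section \<open>Algebra of projections\<close>

lemma projection_compl: "projection P \<Longrightarrow> projection (mat 1 - P)"
  by (simp add: projection_def mat_adj_diff matrix_diff_ldistrib matrix_diff_rdistrib)

lemma projection_orth_commute:
  assumes "projection P" "projection Q" "P ** Q = 0"
  shows "Q ** P = 0"
  using mat_adj_mult[of P Q] assms by (simp add: projection_def)

lemma projection_add:
  assumes "projection P" "projection Q" "P ** Q = 0"
  shows "projection (P + Q)"
  using assms projection_orth_commute[OF assms]
  by (simp add: projection_def mat_adj_add matrix_add_ldistrib matrix_add_rdistrib)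

text \<open>Idempotence of both projections forces c * c = c, and \<open>Q \<noteq> 0\<close> leaves
  only c = 1.\<close>

lemma projection_smult_cancel:
  assumes "projection P" "projection Q" "Q \<noteq> 0" "Q = mat_smult c P"
  shows "Q = P"
proof -
  have "P \<noteq> 0" "c \<noteq> 0" using assms by auto
  have "mat_smult (c * c) P = mat_smult c P"
    using assms by (simp add: projection_def mat_smult_mult_left mat_smult_mult_right mat_smult_smult)
  then have "(c * c - c) * P $ i $ j = 0" for i j
    unfolding left_diff_distrib by (metis mat_smult_nth right_minus_eq)
  with \<open>P \<noteq> 0\<close> have "c * c - c = 0"
    by (auto simp: vec_eq_iff)
  with \<open>c \<noteq> 0\<close> have "c = 1" by simp
  with assms show ?thesis by simp
qed

section \<open>Contexts\<close>

text \<open>Orthogonality kills every term of the expansion of A except the one at P. This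
  minimality of P within V is the source of uniqueness.\<close>

lemma canonical_projection_mult:
  assumes S: "is_canonical_projections V S" and "A \<in> V" "P \<in> S"
  obtains c where "P ** A = mat_smult c P" "A ** P = mat_smult c P"
proof -
  from S \<open>A \<in> V\<close> obtain c where A: "A = (\<Sum>Q\<in>S. mat_smult (c Q) Q)"
    by (auto simp: is_canonical_projections_def)
  have fin: "finite S" and orth: "\<And>P Q. P \<in> S \<Longrightarrow> Q \<in> S \<Longrightarrow> P \<noteq> Q \<Longrightarrow> P ** Q = 0"
    and "projection P"
    using S \<open>P \<in> S\<close> by (auto simp: is_canonical_projections_def)
  then have PP: "P ** P = P" by (simp add: projection_def)
  have "P ** A = (\<Sum>Q\<in>S. if Q = P then mat_smult (c P) P else 0)"
    unfolding A matrix_mult_sum_right mat_smult_mult_right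
    by (rule sum.cong) (use orth \<open>P \<in> S\<close> PP in auto)
  moreover have "A ** P = (\<Sum>Q\<in>S. if Q = P then mat_smult (c P) P else 0)"
    unfolding A matrix_mult_sum_left mat_smult_mult_left
    by (rule sum.cong) (use orth \<open>P \<in> S\<close> PP in auto)
  ultimately show ?thesis
    using that[of "c P"] fin \<open>P \<in> S\<close> by simp
qed

lemma canonical_projection_mem:
  assumes S: "is_canonical_projections V S" and "P \<in> S"
  shows "P \<in> V"
proof -
  have "P = (\<Sum>Q\<in>S. mat_smult (if Q = P then 1 else 0) Q)"
    using assms by (simp add: is_canonical_projections_def if_distrib[of "\<lambda>c. mat_smult c _"] cong: if_cong)
  then show ?thesis
    using S unfolding is_canonical_projections_def by auto
qed

text \<open>As T sums to the identity, some Q in T satisfies \<open>P ** Q \<noteq> 0\<close>. By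
  minimality in both families this product is a multiple of P and of Q, so P and Q are proportional
  and hence equal.\<close>

lemma canonical_projections_subset:
  assumes S: "is_canonical_projections V S" and T: "is_canonical_projections V T"
  shows "S \<subseteq> T"
proof
  fix P assume P: "P \<in> S"
  then have prP: "projection P" "P \<noteq> 0"
    using S by (auto simp: is_canonical_projections_def)
  have "(\<Sum>Q\<in>T. P ** Q) = P"
    using T by (simp flip: matrix_mult_sum_right add: is_canonical_projections_def)
  with \<open>P \<noteq> 0\<close> obtain Q where Q: "Q \<in> T" and PQ: "P ** Q \<noteq> 0"
    by (metis sum.neutral)
  have prQ: "projection Q" "Q \<noteq> 0"
    using T Q by (auto simp: is_canonical_projections_def)
  obtain c where c: "P ** Q = mat_smult c P"
    using canonical_projection_mult[OF S canonical_projection_mem[OF T Q] P] by blast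
  obtain d where d: "P ** Q = mat_smult d Q"
    using canonical_projection_mult[OF T canonical_projection_mem[OF S P] Q] by blast
  have "d \<noteq> 0" using d PQ by auto
  then have "Q = mat_smult (inverse d * c) P"
    using c d by (metis mat_smult_smult mat_smult_one left_inverse)
  then have "Q = P"
    using projection_smult_cancel prP(1) prQ by blast
  with Q show "P \<in> T" by simp
qed

text \<open>The inclusion used in both directions gives the uniqueness required by the definite
  description.\<close>

lemma canonical_projections_eq:
  assumes "is_canonical_projections V S"
  shows "canonical_projections V = S"
  unfolding canonical_projections_def
  using assms canonical_projections_subset by (blast intro!: the_equality)

text \<open>P and its complement are orthogonal idempotents, so products in their span are taken
  coefficientwise. Nontriviality of P makes both nonzero and keeps the span larger than the
  scalars.\<close>

lemma binary_context:
  fixes P :: "complex^'n^'n"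
  assumes P: "projection P" "P \<noteq> 0" "P \<noteq> mat 1"
  obtains V where "V \<in> contexts" "canonical_projections V = {P, mat 1 - P}"
proof
  define Q where "Q = mat 1 - P"
  let ?f = "\<lambda>c d. mat_smult c P + mat_smult d Q"
  define V where "V = {?f c d | c d. True}"
  have Q: "projection Q" "Q \<noteq> 0"
    using P projection_compl by (auto simp: Q_def)
  have PP: "P ** P = P" "Q ** Q = Q" "mat_adj P = P" "mat_adj Q = Q"
    using P Q by (auto simp: projection_def)
  have PQ: "P ** Q = 0" "Q ** P = 0"
    using PP by (simp_all add: Q_def matrix_diff_ldistrib matrix_diff_rdistrib)
  \<comment> \<open>Equality would give P = P ** P = P ** Q = 0. Distinctness lets sums over
    \<open>{P, Q}\<close> split into two terms.\<close>
  have "P \<noteq> Q" using P PP PQ by auto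
  have sum1: "P + Q = mat 1" by (simp add: Q_def)
  have V_range: "V = range (\<lambda>c. \<Sum>R\<in>{P, Q}. mat_smult (c R) R)"
  proof (intro equalityI subsetI)
    fix A assume "A \<in> V"
    then obtain c d where "A = ?f c d" by (auto simp: V_def)
    then have "A = (\<Sum>R\<in>{P, Q}. mat_smult ((\<lambda>R. if R = P then c else d) R) R)"
      using \<open>P \<noteq> Q\<close> by auto
    then show "A \<in> range (\<lambda>c. \<Sum>R\<in>{P, Q}. mat_smult (c R) R)"
      by (intro image_eqI[where x = "\<lambda>R. if R = P then c else d"] UNIV_I)
  qed (use \<open>P \<noteq> Q\<close> in \<open>auto simp: V_def\<close>)
  have "is_canonical_projections V {P, Q}"
    unfolding is_canonical_projections_def
    using P Q PQ \<open>P \<noteq> Q\<close> sum1 V_range by simp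
  then show "canonical_projections V = {P, mat 1 - P}"
    unfolding Q_def by (rule canonical_projections_eq)
  have mult: "?f c d ** ?f c' d' = ?f (c * c') (d * d')" for c d c' d'
    by (simp add: matrix_add_ldistrib matrix_add_rdistrib mat_smult_mult_left mat_smult_mult_right
        mat_smult_smult PP PQ mult.commute)
  have memI: "?f c d \<in> V" for c d by (auto simp: V_def)
  have "star_subalgebra V"
    unfolding star_subalgebra_def
  proof (intro conjI ballI allI)
    show "0 \<in> V" using memI[of 0 0] by simp
  next
    fix A B assume "A \<in> V" "B \<in> V"
    then obtain a b c d where A: "A = ?f a b" "B = ?f c d" by (auto simp: V_def)
    have "A + B = ?f (a + c) (b + d)" by (simp add: A mat_smult_add_left)
    then show "A + B \<in> V" using memI by metis
    show "A ** B \<in> V" using mult A memI by metis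
  next
    fix c A assume "A \<in> V"
    then obtain a b where "A = ?f a b" by (auto simp: V_def)
    then have "mat_smult c A = ?f (c * a) (c * b)"
      by (simp add: mat_smult_add_right mat_smult_smult)
    then show "mat_smult c A \<in> V" using memI by metis
  next
    fix A assume "A \<in> V"
    then obtain a b where "A = ?f a b" by (auto simp: V_def)
    then have "mat_adj A = ?f (cnj a) (cnj b)"
      by (simp add: mat_adj_add mat_adj_smult PP)
    then show "mat_adj A \<in> V" using memI by metis
  qed
  moreover have "A ** B = B ** A" if "A \<in> V" "B \<in> V" for A B
    using that by (auto simp: V_def mult mult.commute)
  moreover have "mat 1 \<in> V" using memI[of 1 1] sum1 by simp
  moreover have "V \<noteq> range (\<lambda>c. mat_smult c (mat 1))"
  proof
    assume "V = range (\<lambda>c. mat_smult c (mat 1))"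
    moreover have "P \<in> V" using memI[of 1 0] by simp
    ultimately obtain c where "P = mat_smult c (mat 1)" by auto
    then have "P = mat 1"
      using projection_smult_cancel[of "mat 1" P c] P by (simp add: projection_def)
    with P show False by simp
  qed
  ultimately show "V \<in> contexts" by (auto simp: contexts_def)
qed

section \<open>Expectation values of projections\<close>

lemma matrix_vector_scaleR: "(A :: complex^'n^'m) *v (r *\<^sub>R x) = r *\<^sub>R (A *v x)"
  by (simp add: vec_eq_iff matrix_vector_mult_def scaleR_right.sum)

lemma selfadjoint_cinner:
  assumes "mat_adj A = A"
  shows "cinner x (A *v y) = cinner (A *v x) y"
proof -
  have A: "cnj (A $ j $ i) = A $ i $ j" for i j
    using assms mat_adj_nth by metis
  have "cinner x (A *v y) = (\<Sum>i\<in>UNIV. \<Sum>j\<in>UNIV. cnj (x $ i) * (A $ i $ j * y $ j))"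
    by (simp add: cinner_def matrix_vector_mult_def sum_distrib_left)
  also have "\<dots> = (\<Sum>j\<in>UNIV. \<Sum>i\<in>UNIV. cnj (x $ i) * (A $ i $ j * y $ j))"
    by (rule sum.swap)
  also have "\<dots> = cinner (A *v x) y"
    by (simp add: cinner_def matrix_vector_mult_def sum_distrib_left sum_distrib_right A mult_ac)
  finally show ?thesis .
qed

lemma selfadjoint_inner:
  assumes "mat_adj A = A"
  shows "x \<bullet> (A *v y) = (A *v x) \<bullet> y"
  using selfadjoint_cinner[OF assms, of x y] by (metis Re_cinner)

lemma density_adj: "density_matrix \<rho> \<Longrightarrow> mat_adj \<rho> = \<rho>"
  by (simp add: density_matrix_def pos_semidef_def)

lemma density_nonneg: "density_matrix \<rho> \<Longrightarrow> 0 \<le> v \<bullet> (\<rho> *v v)"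
  by (simp add: density_matrix_def pos_semidef_def flip: cinner_def Re_cinner)

text \<open>By cyclicity Tr(rho P) = Tr(P rho P), whose diagonal entries are values of the form of
  rho on the range of P. Thus positivity, or vanishing, of the form on that range passes to the
  expectation.\<close>

lemma expect_eq_sum_form:
  fixes \<rho> P :: "complex^'n^'n"
  assumes "projection P"
  shows "expect \<rho> P = (\<Sum>i\<in>UNIV. (P *v axis i 1) \<bullet> (\<rho> *v (P *v axis i 1)))"
proof -
  have diag: "Re (A $ i $ i) = axis i 1 \<bullet> (A *v axis i 1)" for A :: "complex^'n^'n" and i
  proof -
    have "(A *v axis i 1) $ i = A $ i $ i"
      by (simp add: matrix_vector_mult_def axis_def if_distrib[of "\<lambda>z. _ * z"] cong: if_cong)
    then show ?thesis
      by (simp add: inner_axis' inner_complex_def)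
  qed
  have P: "mat_adj P = P" "P ** P = P" using assms by (auto simp: projection_def)
  have "trace (\<rho> ** P) = trace (P ** \<rho> ** P)"
    by (metis P(2) matrix_mul_assoc trace_mul_sym)
  then have "expect \<rho> P = (\<Sum>i\<in>UNIV. axis i 1 \<bullet> ((P ** \<rho> ** P) *v axis i 1))"
    by (simp add: expect_def trace_def diag)
  then show ?thesis
    using P by (simp flip: matrix_vector_mul_assoc add: selfadjoint_inner matrix_mul_assoc)
qed

lemma expect_nonneg: "density_matrix \<rho> \<Longrightarrow> projection P \<Longrightarrow> 0 \<le> expect \<rho> P"
  by (simp add: expect_eq_sum_form sum_nonneg density_nonneg)

lemma expect_add: "expect \<rho> (P + Q) = expect \<rho> P + expect \<rho> Q"
  by (simp add: expect_def matrix_add_ldistrib trace_add)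

lemma expect_compl: "density_matrix \<rho> \<Longrightarrow> expect \<rho> (mat 1 - P) = 1 - expect \<rho> P"
  by (simp add: expect_def matrix_diff_ldistrib trace_sub density_matrix_def)

lemma expect_le_1: "density_matrix \<rho> \<Longrightarrow> projection P \<Longrightarrow> expect \<rho> P \<le> 1"
  using expect_nonneg[of \<rho> "mat 1 - P"] by (simp add: projection_compl expect_compl)

section \<open>Binary entropy\<close>

definition binary_entropy :: "real \<Rightarrow> real" where
  "binary_entropy x = - (x * ln x + (1 - x) * ln (1 - x))"

lemma binary_entropy_compl: "binary_entropy (1 - x) = binary_entropy x"
  by (simp add: binary_entropy_def)

lemma binary_entropy_pos:
  assumes "0 < x" "x < 1"
  shows "0 < binary_entropy x"
proof -
  have "x * ln x < 0" "(1 - x) * ln (1 - x) < 0"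
    using assms by (auto intro!: mult_pos_neg)
  then show ?thesis by (simp add: binary_entropy_def)
qed

text \<open>The derivative ln (1 - t) - ln t is positive on (0, 1/2). The endpoint 0 lies outside
  the derivative formula and is compared directly: the entropy is 0 there and positive
  inside.\<close>

lemma binary_entropy_strict_mono:
  assumes "0 \<le> x" "x < y" "y \<le> 1/2"
  shows "binary_entropy x < binary_entropy y"
proof (cases "x = 0")
  case True
  then show ?thesis
    using binary_entropy_pos[of y] assms by (simp add: binary_entropy_def)
next
  case False
  have deriv: "(binary_entropy has_real_derivative ln (1 - t) - ln t) (at t)"
    if "0 < t" "t < 1" for t
    unfolding binary_entropy_def[abs_def]
    by (rule derivative_eq_intros refl | use that in simp)+
  show ?thesis
  proof (rule DERIV_pos_imp_increasing_open[OF \<open>x < y\<close>])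
    fix t assume "x < t" "t < y"
    then show "\<exists>d. (binary_entropy has_real_derivative d) (at t) \<and> 0 < d"
      using deriv[of t] assms by (intro exI[of _ "ln (1 - t) - ln t"]) auto
  next
    show "continuous_on {x..y} binary_entropy"
    proof (rule continuous_at_imp_continuous_on, rule ballI)
      fix t assume "t \<in> {x..y}"
      then show "isCont binary_entropy t"
        using deriv[of t] assms False by (auto intro: DERIV_isCont)
    qed
  qed
qed

text \<open>Reflecting both arguments into [0, 1/2], where the entropy is injective, loses exactly
  the symmetry t to 1 - t.\<close>

lemma binary_entropy_eqD:
  assumes "binary_entropy x = binary_entropy y" "0 \<le> x" "x \<le> 1" "0 \<le> y" "y \<le> 1"
  shows "y = x \<or> y = 1 - x"
proof -
  define x' y' where "x' = min x (1 - x)" and "y' = min y (1 - y)"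
  have "binary_entropy x' = binary_entropy y'"
    using assms(1) by (simp add: x'_def y'_def min_def binary_entropy_compl)
  moreover have "0 \<le> x'" "x' \<le> 1/2" "0 \<le> y'" "y' \<le> 1/2"
    using assms by (auto simp: x'_def y'_def min_def)
  ultimately have "x' = y'"
    using binary_entropy_strict_mono[of x' y'] binary_entropy_strict_mono[of y' x'] by linarith
  then show ?thesis by (auto simp: x'_def y'_def min_def split: if_splits)
qed

text \<open>The entropy hypothesis is evaluated at the context of P and its complement. The
  projections 0 and 1 span only scalars, but their expectations are 0 and 1 in every state.\<close>

lemma expect_dichotomy:
  fixes \<rho> \<sigma> :: "complex^'n^'n"
  assumes \<rho>: "density_matrix \<rho>" and \<sigma>: "density_matrix \<sigma>"
    and eq: "\<forall>V\<in>contexts. contextual_entropy \<rho> V = contextual_entropy \<sigma> V"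
    and P: "projection P"
  shows "expect \<sigma> P = expect \<rho> P \<or> expect \<sigma> P = 1 - expect \<rho> P"
proof -
  consider "P = 0" | "P = mat 1" | "P \<noteq> 0" "P \<noteq> mat 1" by blast
  then show ?thesis
  proof cases
    case 1
    then show ?thesis by (simp add: expect_def)
  next
    case 2
    then show ?thesis using \<rho> \<sigma> by (simp add: expect_def density_matrix_def)
  next
    case 3
    obtain V where V: "V \<in> contexts" "canonical_projections V = {P, mat 1 - P}"
      using binary_context[OF P 3] .
    \<comment> \<open>Otherwise the entropy sum over the set would collapse to one term.\<close>
    have "P \<noteq> mat 1 - P"
    proof
      assume "P = mat 1 - P"
      then have "P ** P = P ** (mat 1 - P)" by (rule arg_cong)
      then show False using P 3 by (simp add: projection_def matrix_diff_ldistrib)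
    qed
    then have "contextual_entropy \<tau> V = binary_entropy (expect \<tau> P)"
      if "density_matrix \<tau>" for \<tau>
      using expect_compl[OF that, of P]
      by (simp add: contextual_entropy_def V binary_entropy_def flip: expect_def)
    then have "binary_entropy (expect \<rho> P) = binary_entropy (expect \<sigma> P)"
      using eq V(1) \<rho> \<sigma> by force
    then show ?thesis
      using \<rho> \<sigma> P by (intro binary_entropy_eqD expect_nonneg expect_le_1)
  qed
qed

text \<open>Let p and q be the values of rho at P and Q; sigma has 1 - p at P, and p is not 1/2. If
  sigma has q at Q, the dichotomy at P + Q leaves only q = 0. If it has 1 - q, the bounds p + q
  \<le> 1 and (1 - p) + (1 - q) \<le> 1 force q = 1 - p.\<close>

lemma expect_orthogonal:
  assumes \<rho>: "density_matrix \<rho>" and \<sigma>: "density_matrix \<sigma>"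
    and dich: "\<And>P. projection P \<Longrightarrow> expect \<sigma> P = expect \<rho> P \<or> expect \<sigma> P = 1 - expect \<rho> P"
    and P: "projection P" "expect \<sigma> P \<noteq> expect \<rho> P"
    and Q: "projection Q" "P ** Q = 0"
  shows "expect \<rho> Q = 0 \<or> expect \<rho> Q = 1 - expect \<rho> P"
proof -
  have PQ: "projection (P + Q)" using P Q by (intro projection_add)
  show ?thesis
    using dich[OF P(1)] dich[OF Q(1)] dich[OF PQ] P(2)
      expect_le_1[OF \<rho> PQ] expect_le_1[OF \<sigma> PQ]
    unfolding expect_add by linarith
qed

section \<open>Rank-one projections\<close>

lemma rank_one_mult: "rank_one x ** rank_one y = (\<chi> i j. x $ i * cinner x y * cnj (y $ j))"
  by (simp add: vec_eq_iff rank_one_def matrix_matrix_mult_def cinner_def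
      sum_distrib_left sum_distrib_right mult_ac)

lemma rank_one_orth: "cinner x y = 0 \<Longrightarrow> rank_one x ** rank_one y = 0"
  by (simp add: rank_one_mult vec_eq_iff)

lemma projection_rank_one: "x \<bullet> x = 1 \<Longrightarrow> projection (rank_one x)"
  unfolding projection_def rank_one_mult cinner_self
  by (simp add: vec_eq_iff rank_one_def mat_adj_nth)

lemma rank_one_vector: "rank_one x *v y = (\<chi> i. x $ i * cinner x y)"
  by (simp add: vec_eq_iff rank_one_def matrix_vector_mult_def cinner_def
      sum_distrib_left mult_ac)

lemma rank_one_self: "x \<bullet> x = 1 \<Longrightarrow> rank_one x *v x = x"
  by (simp add: rank_one_vector cinner_self vec_eq_iff)

lemma trace_rank_one: "trace (rank_one x) = cinner x x"
  by (simp add: trace_def rank_one_def cinner_def mult.commute)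

lemma expect_rank_one: "expect \<rho> (rank_one x) = x \<bullet> (\<rho> *v x)"
proof -
  have "trace (\<rho> ** rank_one x) = cinner x (\<rho> *v x)"
    by (simp add: trace_def rank_one_def cinner_def matrix_matrix_mult_def
        matrix_vector_mult_def sum_distrib_left mult_ac)
  then show ?thesis by (simp add: expect_def Re_cinner)
qed

text \<open>The projection onto the complement of x and y has trace n - 2 > 0, so it is nonzero.
  Being self-adjoint and zero on x and y, it has range orthogonal to both; z is a normalized vector
  of that range.\<close>

lemma orthonormal_third:
  fixes x y :: "complex^'n"
  assumes n: "CARD('n) \<ge> 3" and xy: "x \<bullet> x = 1" "y \<bullet> y = 1" "cinner x y = 0"
  obtains z where "z \<bullet> z = 1" "cinner x z = 0" "cinner y z = 0"
proof -
  define Q where "Q = mat 1 - (rank_one x + rank_one y)"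
  have pr: "projection (rank_one x + rank_one y)"
    using xy by (intro projection_add projection_rank_one rank_one_orth)
  have "mat_adj Q = Q" using projection_compl[OF pr] by (simp add: Q_def projection_def)
  have "rank_one y *v x = 0" "rank_one x *v y = 0"
    using xy cinner_commute[of x y] by (simp_all add: rank_one_vector vec_eq_iff)
  then have ker: "Q *v x = 0" "Q *v y = 0"
    using xy by (simp_all add: Q_def matrix_vector_mult_diff_rdistrib
        matrix_vector_mult_add_rdistrib rank_one_self)
  have "trace Q = of_nat CARD('n) - 2"
    using xy by (simp add: Q_def trace_sub trace_add trace_rank_one cinner_self trace_I)
  then have "Q \<noteq> 0"
    using n by (auto simp: trace_def dest: arg_cong[where f = Re])
  then obtain v where v: "Q *v v \<noteq> 0"
    by (metis matrix_eq matrix_vector_mult_0)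
  define z where "z = (1 / norm (Q *v v)) *\<^sub>R (Q *v v)"
  show ?thesis
  proof
    show "z \<bullet> z = 1"
      using v by (simp add: z_def dot_square_norm power2_eq_square)
    show "cinner x z = 0" "cinner y z = 0"
      using ker by (simp_all add: z_def cinner_scaleR_right selfadjoint_cinner[OF \<open>mat_adj Q = Q\<close>])
        (simp_all add: cinner_def)
  qed
qed

section \<open>Quadratic forms of states\<close>

lemma form_combination:
  assumes "mat_adj \<rho> = \<rho>"
  shows "(a *\<^sub>R y + b *\<^sub>R z) \<bullet> (\<rho> *v (a *\<^sub>R y + b *\<^sub>R z)) =
    a\<^sup>2 * (y \<bullet> (\<rho> *v y)) + b\<^sup>2 * (z \<bullet> (\<rho> *v z)) + 2 * a * b * (y \<bullet> (\<rho> *v z))"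
proof -
  \<comment> \<open>Self-adjointness merges the two cross terms into one.\<close>
  have "z \<bullet> (\<rho> *v y) = y \<bullet> (\<rho> *v z)"
    using selfadjoint_inner[OF assms] by (metis inner_commute)
  then show ?thesis
    by (simp add: matrix_vector_right_distrib matrix_vector_scaleR inner_add_left inner_add_right
        power2_eq_square algebra_simps)
qed

text \<open>In the application d is \<open>1 - expect \<rho> (rank_one x)\<close>. The third
  dimension supplies the companion z of y.\<close>

lemma orthogonal_form_eq_0:
  fixes \<rho> :: "complex^'n^'n"
  assumes n: "CARD('n) \<ge> 3" and \<rho>: "density_matrix \<rho>" and x: "x \<bullet> x = 1"
    and orth: "\<And>Q. projection Q \<Longrightarrow> rank_one x ** Q = 0 \<Longrightarrow> expect \<rho> Q = 0 \<or> expect \<rho> Q = d"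
    and y: "y \<bullet> y = 1" "cinner x y = 0"
  shows "y \<bullet> (\<rho> *v y) = 0"
proof (rule ccontr)
  assume nz: "y \<bullet> (\<rho> *v y) \<noteq> 0"
  have val: "u \<bullet> (\<rho> *v u) = 0 \<or> u \<bullet> (\<rho> *v u) = d" if "u \<bullet> u = 1" "cinner x u = 0" for u
    using orth[of "rank_one u"] that by (simp add: projection_rank_one rank_one_orth expect_rank_one)
  from nz val[OF y] have yd: "y \<bullet> (\<rho> *v y) = d" and "d \<noteq> 0" by auto
  obtain z where z: "z \<bullet> z = 1" "cinner x z = 0" "cinner y z = 0"
    using orthonormal_third[OF n x y] .
  have yz: "y \<bullet> z = 0" using z(3) Re_cinner[of y z] by simp
  \<comment> \<open>The vector a y + b z is again a unit vector orthogonal to x, so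
    \<open>val\<close> constrains the expanded form.\<close>
  have comb: "a\<^sup>2 * d + b\<^sup>2 * (z \<bullet> (\<rho> *v z)) + 2 * a * b * (y \<bullet> (\<rho> *v z)) \<in> {0, d}"
    if "a\<^sup>2 + b\<^sup>2 = 1" for a b
  proof -
    have "(a *\<^sub>R y + b *\<^sub>R z) \<bullet> (a *\<^sub>R y + b *\<^sub>R z) = 1"
      using that y z yz by (simp add: inner_add_left inner_add_right inner_commute power2_eq_square)
    moreover have "cinner x (a *\<^sub>R y + b *\<^sub>R z) = 0"
      using y z by (simp add: cinner_add_right cinner_scaleR_right)
    ultimately show ?thesis
      using val form_combination[OF density_adj[OF \<rho>]] yd by (metis insertCI)
  qed
  \<comment> \<open>Were the values at \<open>y\<close> and \<open>z\<close> different, the two rational rotations would give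
    incompatible values of the cross term.\<close>
  have "z \<bullet> (\<rho> *v z) = d"
    using val[OF z(1,2)] comb[of "3/5" "4/5"] comb[of "4/5" "3/5"] \<open>d \<noteq> 0\<close>
    by (auto simp: power2_eq_square)
  \<comment> \<open>The sum projects onto a plane orthogonal to x, so \<open>orth\<close> applies;
    yet its expectation is 2 d.\<close>
  moreover have "expect \<rho> (rank_one y + rank_one z) = 0 \<or> expect \<rho> (rank_one y + rank_one z) = d"
    using y z x by (intro orth)
      (simp_all add: projection_add projection_rank_one rank_one_orth matrix_add_ldistrib)
  ultimately show False
    using yd \<open>d \<noteq> 0\<close> by (auto simp: expect_add expect_rank_one)
qed

text \<open>The expectation of the complement of \<open>rank_one x\<close> is a sum of form values
  at vectors orthogonal to x, all of which vanish.\<close>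

lemma expect_eq_1_if_differs:
  fixes \<rho> \<sigma> :: "complex^'n^'n"
  assumes n: "CARD('n) \<ge> 3" and \<rho>: "density_matrix \<rho>" and \<sigma>: "density_matrix \<sigma>"
    and dich: "\<And>P. projection P \<Longrightarrow> expect \<sigma> P = expect \<rho> P \<or> expect \<sigma> P = 1 - expect \<rho> P"
    and x: "x \<bullet> x = 1" and differs: "expect \<sigma> (rank_one x) \<noteq> expect \<rho> (rank_one x)"
  shows "expect \<rho> (rank_one x) = 1"
proof -
  let ?Q = "mat 1 - rank_one x"
  have P: "projection (rank_one x)" using x by (rule projection_rank_one)
  have Q: "projection ?Q" using P by (rule projection_compl)
  have unit: "y \<bullet> (\<rho> *v y) = 0" if "y \<bullet> y = 1" "cinner x y = 0" for y
    using orthogonal_form_eq_0[OF n \<rho> x _ that] expect_orthogonal[OF \<rho> \<sigma> dich P differs] by blast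
  have all: "y \<bullet> (\<rho> *v y) = 0" if "cinner x y = 0" for y
  proof (cases "y = 0")
    case False
    define u where "u = (1 / norm y) *\<^sub>R y"
    have y: "y = norm y *\<^sub>R u" using False by (simp add: u_def)
    have "u \<bullet> (\<rho> *v u) = 0"
      using False that
      by (intro unit) (simp_all add: u_def cinner_scaleR_right dot_square_norm power2_eq_square)
    then show ?thesis
      by (subst (1 2) y) (simp add: matrix_vector_scaleR)
  qed simp
  \<comment> \<open>\<open>?Q\<close> is self-adjoint and annihilates x, so its range is orthogonal
    to x.\<close>
  have "cinner x (?Q *v v) = 0" for v
  proof -
    have "?Q *v x = 0" using x by (simp add: matrix_vector_mult_diff_rdistrib rank_one_self)
    moreover have "mat_adj ?Q = ?Q" using Q by (simp add: projection_def)
    ultimately show ?thesis by (simp add: selfadjoint_cinner) (simp add: cinner_def)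
  qed
  then have "expect \<rho> ?Q = 0"
    using Q by (simp add: expect_eq_sum_form all)
  then show ?thesis using \<rho> by (simp add: expect_compl)
qed

text \<open>Polarization: the values at v, w and v + w remove the cross term, so D w is orthogonal
  to every vector, itself included.\<close>

lemma selfadjoint_form_eq_0_imp_eq_0:
  assumes D: "mat_adj D = D" and form: "\<And>v. v \<bullet> (D *v v) = 0"
  shows "D = 0"
proof -
  have "D *v w = 0" for w
  proof -
    have "v \<bullet> (D *v w) = 0" for v
      using form_combination[OF D, of 1 v 1 w] form[of "v + w"] form[of v] form[of w] by simp
    then show ?thesis by (metis inner_eq_zero_iff)
  qed
  then show ?thesis by (simp add: matrix_eq)
qed

theorem mainTheorem1:
  fixes \<rho> \<sigma> :: "complex^'n^'n"
  assumes "CARD('n) \<ge> 3"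
    and "density_matrix \<rho>" and "density_matrix \<sigma>"
    and "\<forall>V\<in>contexts. contextual_entropy \<rho> V = contextual_entropy \<sigma> V"
  shows "\<rho> = \<sigma>"
proof -
  note n = assms(1) and \<rho> = assms(2) and \<sigma> = assms(3)
  have dich: "expect \<sigma> P = expect \<rho> P \<or> expect \<sigma> P = 1 - expect \<rho> P" if "projection P" for P
    using expect_dichotomy[OF assms(2-4) that] .
  \<comment> \<open>The dichotomy is symmetric in the two states, so their roles may be exchanged
    below.\<close>
  then have dich': "expect \<rho> P = expect \<sigma> P \<or> expect \<rho> P = 1 - expect \<sigma> P" if "projection P" for P
    using that by fastforce
  \<comment> \<open>If the two values differed, both would equal 1.\<close>
  have "expect \<sigma> (rank_one x) = expect \<rho> (rank_one x)" if "x \<bullet> x = 1" for x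
    using expect_eq_1_if_differs[OF n \<rho> \<sigma> dich that] expect_eq_1_if_differs[OF n \<sigma> \<rho> dich' that]
    by force
  then have unit: "x \<bullet> ((\<rho> - \<sigma>) *v x) = 0" if "x \<bullet> x = 1" for x
    using that by (simp add: expect_rank_one matrix_vector_mult_diff_rdistrib inner_diff_right)
  have "v \<bullet> ((\<rho> - \<sigma>) *v v) = 0" for v
  proof (cases "v = 0")
    case False
    \<comment> \<open>The form is homogeneous of degree 2, so it is enough to know it on unit
      vectors.\<close>
    define u where "u = (1 / norm v) *\<^sub>R v"
    have v: "v = norm v *\<^sub>R u" using False by (simp add: u_def)
    have "u \<bullet> ((\<rho> - \<sigma>) *v u) = 0"
      using False by (intro unit) (simp add: u_def dot_square_norm power2_eq_square)
    then show ?thesis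
      by (subst (1 2) v) (simp add: matrix_vector_scaleR)
  qed simp
  then have "\<rho> - \<sigma> = 0"
    using \<rho> \<sigma> by (intro selfadjoint_form_eq_0_imp_eq_0) (auto simp: mat_adj_diff density_adj)
  then show ?thesis by simp
qed

end
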